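(* For every $n\in\mathbb{Z}^+\setminus\{1,3\}$ there exists a graph $G_n$ such that $\gamma_{\rm gr}^t(G_n)=n$.
   Context: All graphs are finite and simple. For a vertex $v$, $N(v)$ is its open neighborhood. A sequence $(v_1,\ldots,v_k)$ of distinct vertices is legal if for every $i\in\{1,\ldots,k\}$, $N(v_i)\setminus\bigcup_{j=1}^{i-1}N(v_j)\neq\emptyset$; it is a total dominating sequence if in addition every vertex has a neighbor among $v_1,\ldots,v_k$. $\gamma_{\rm gr}^t(G)$ is the maximum length of a legal sequence (for graphs with no isolated vertices, the maximum length of a total dominating sequence). *)

theory Defs
  imports "Graph_Theory.Pair_Digraph"
begin

text \<open>
  A finite simple graph is a \<^locale>\<open>pair_graph\<close>: finitely many vertices, and an
  irreflexive symmetric set of ordered pairs of vertices, where the two pairs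
  \<open>(u, v)\<close> and \<open>(v, u)\<close> together stand for one undirected edge.
\<close>

definition open_nbhd :: "'a pair_pre_digraph \<Rightarrow> 'a \<Rightarrow> 'a set" where
  "open_nbhd G v = {u \<in> pverts G. (v, u) \<in> parcs G}"

definition legal_seq :: "'a pair_pre_digraph \<Rightarrow> 'a list \<Rightarrow> bool" where
  "legal_seq G vs \<longleftrightarrow>
     set vs \<subseteq> pverts G \<and> distinct vs \<and>
     (\<forall>i < length vs. open_nbhd G (vs ! i) - (\<Union>j<i. open_nbhd G (vs ! j)) \<noteq> {})"

text \<open>
  The empty sequence is legal, so the maximum is taken over a nonempty set; it is finite
  for a finite vertex set because legal sequences have distinct entries.
\<close>

definition grundy_total_dom :: "'a pair_pre_digraph \<Rightarrow> nat" where
  "grundy_total_dom G = Max {length vs | vs. legal_seq G vs}"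

lemma legal_seq_Nil: "legal_seq G []"
  by (simp add: legal_seq_def)

lemma finite_legal_lengths:
  assumes "finite (pverts G)"
  shows "finite {length vs | vs. legal_seq G vs}"
proof (rule finite_subset)
  show "{length vs | vs. legal_seq G vs} \<subseteq> {.. card (pverts G)}"
    using assms by (auto simp: legal_seq_def) (metis card_mono distinct_card)
qed simp

end

theory Submission
  imports Defs
begin

text \<open>
  Adding a disjoint edge raises the invariant by exactly 2, so it suffices to realise the
  values 0 and 5. The empty graph gives 0. Two triangles joined by an edge give 5: the graph
  has 6 vertices and minimum degree 2, the first vertex of a legal sequence dominates at least
  2 vertices and each later one dominates a new vertex, so a legal sequence has length at most
  5; and one of that length exists.
\<close>

text \<open>Appending a vertex leaves the footprint conditions of all earlier positions untouched.
  This turns the indexed definition into a recursion on the last vertex, suited to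
  \<open>rev_induct\<close> and to checking concrete sequences.\<close>

lemma legal_seq_snoc:
  "legal_seq G (vs @ [v]) \<longleftrightarrow>
     legal_seq G vs \<and> v \<in> pverts G \<and> v \<notin> set vs \<and>
     open_nbhd G v - \<Union> (open_nbhd G ` set vs) \<noteq> {}"
proof -
  have "(\<Union>j<length vs. open_nbhd G ((vs @ [v]) ! j)) = \<Union> (open_nbhd G ` set vs)"
    by (auto simp: set_conv_nth nth_append)
  moreover have "(\<Union>j<i. open_nbhd G ((vs @ [v]) ! j)) = (\<Union>j<i. open_nbhd G (vs ! j))"
    if "i < length vs" for i
    using that by (auto simp: nth_append)
  ultimately show ?thesis
    unfolding legal_seq_def
    by (auto simp: less_Suc_eq all_conj_distrib nth_append simp del: UN_iff UN_simps)
qed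

lemma grundy_total_dom_eqI:
  assumes "finite (pverts G)" "legal_seq G vs"
    and "\<And>ws. legal_seq G ws \<Longrightarrow> length ws \<le> length vs"
  shows "grundy_total_dom G = length vs"
  unfolding grundy_total_dom_def
  by (rule Max_eqI) (use assms finite_legal_lengths in auto)

lemma legal_seq_length_le_grundy:
  assumes "finite (pverts G)" "legal_seq G vs"
  shows "length vs \<le> grundy_total_dom G"
  unfolding grundy_total_dom_def
  by (rule Max_ge) (use assms finite_legal_lengths in auto)

lemma grundy_total_dom_attained:
  assumes "finite (pverts G)"
  obtains vs where "legal_seq G vs" "length vs = grundy_total_dom G"
proof -
  have "grundy_total_dom G \<in> {length vs | vs. legal_seq G vs}"
    unfolding grundy_total_dom_def
    by (rule Max_in) (use assms finite_legal_lengths legal_seq_Nil in auto)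
  then show ?thesis using that by auto
qed

lemma legal_seq_length_min_degree:
  assumes fin: "finite (pverts G)"
    and deg: "\<And>v. v \<in> pverts G \<Longrightarrow> d \<le> card (open_nbhd G v)"
    and "legal_seq G vs" "vs \<noteq> []"
  shows "length vs + d \<le> card (pverts G) + 1"
proof -
  have fin_nb: "finite (\<Union> (open_nbhd G ` A))" for A
    by (rule finite_subset[OF _ fin]) (auto simp: open_nbhd_def)
  \<comment> \<open>The induction needs the sharper bound by the set dominated so far: this set
    strictly grows with each new vertex, whereas \<open>pverts G\<close> stays fixed.\<close>
  have "length vs + d \<le> card (\<Union> (open_nbhd G ` set vs)) + 1"
    using assms(3,4)
  proof (induction vs rule: rev_induct)
    case Nil
    then show ?case by simp
  next
    case (snoc v vs)
    show ?case
    \<comment> \<open>The first vertex accounts for \<open>d\<close> dominated vertices at once;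
      every later one accounts for at least one more.\<close>
    proof (cases "vs = []")
      case True
      then show ?thesis using snoc.prems deg[of v] by (simp add: legal_seq_def)
    next
      case False
      have "\<Union> (open_nbhd G ` set vs) \<subset> \<Union> (open_nbhd G ` set (vs @ [v]))"
        using snoc.prems by (auto simp: legal_seq_snoc)
      then have "card (\<Union> (open_nbhd G ` set vs)) < card (\<Union> (open_nbhd G ` set (vs @ [v])))"
        by (rule psubset_card_mono[OF fin_nb])
      then show ?thesis using snoc False by (auto simp: legal_seq_snoc)
    qed
  qed
  also have "card (\<Union> (open_nbhd G ` set vs)) \<le> card (pverts G)"
    by (rule card_mono[OF fin]) (auto simp: open_nbhd_def)
  finally show ?thesis by simp
qed

definition add_disjoint_edge :: "'a pair_pre_digraph \<Rightarrow> 'a \<Rightarrow> 'a \<Rightarrow> 'a pair_pre_digraph" where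
  "add_disjoint_edge G a b =
     \<lparr>pverts = {a, b} \<union> pverts G, parcs = {(a, b), (b, a)} \<union> parcs G\<rparr>"

lemma pverts_add_disjoint_edge: "pverts (add_disjoint_edge G a b) = {a, b} \<union> pverts G"
  by (simp add: add_disjoint_edge_def)

lemma pair_graph_add_disjoint_edge:
  assumes "pair_graph G" "a \<noteq> b"
  shows "pair_graph (add_disjoint_edge G a b)"
proof -
  interpret pair_graph G by fact
  show ?thesis
    using assms(2) sym_arcs no_loops arc_fst_in_verts arc_snd_in_verts
    by unfold_locales
      (fastforce simp: add_disjoint_edge_def symmetric_def sym_def)+
qed

text \<open>The neighborhoods of \<open>a\<close> and \<open>b\<close> are two distinct singletons
  that meet no neighborhood of a vertex of \<open>G\<close>. Hence both can be appended to a longest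
  legal sequence of \<open>G\<close>, and deleting them from a legal sequence of the larger graph
  leaves one of \<open>G\<close>.\<close>

lemma grundy_total_dom_add_disjoint_edge:
  assumes "pair_graph G" and ab: "a \<noteq> b" "a \<notin> pverts G" "b \<notin> pverts G"
  shows "grundy_total_dom (add_disjoint_edge G a b) = grundy_total_dom G + 2"
proof -
  interpret pair_graph G by fact
  let ?H = "add_disjoint_edge G a b"
  have nb: "open_nbhd ?H a = {b}" "open_nbhd ?H b = {a}"
    "\<And>v. v \<in> pverts G \<Longrightarrow> open_nbhd ?H v = open_nbhd G v"
    using ab arc_fst_in_verts arc_snd_in_verts
    by (fastforce simp: open_nbhd_def add_disjoint_edge_def)+
  have nb_sub: "open_nbhd G v \<subseteq> pverts G" for v
    by (auto simp: open_nbhd_def)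
  \<comment> \<open>Deleting entries only shrinks the union of the earlier neighborhoods, so a
    vertex that was newly dominated remains so.\<close>
  have restrict: "legal_seq G (filter (\<lambda>v. v \<in> pverts G) ws)" if "legal_seq ?H ws" for ws
    using that
  proof (induction ws rule: rev_induct)
    case (snoc v ws)
    then show ?case
      by (fastforce simp: legal_seq_snoc nb)
  qed (simp add: legal_seq_Nil)
  have extend: "legal_seq ?H vs" if "legal_seq G vs" for vs
    using that
  proof (induction vs rule: rev_induct)
    case (snoc v vs)
    moreover have "set vs \<subseteq> pverts G"
      using snoc.prems by (simp add: legal_seq_def)
    ultimately show ?case
      by (fastforce simp: legal_seq_snoc nb pverts_add_disjoint_edge)
  qed (simp add: legal_seq_Nil)
  obtain vs where vs: "legal_seq G vs" "length vs = grundy_total_dom G"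
    using grundy_total_dom_attained[OF finite_verts] by auto
  have "set vs \<subseteq> pverts G"
    using vs(1) by (simp add: legal_seq_def)
  then have "open_nbhd ?H v \<subseteq> pverts G" if "v \<in> set vs" for v
    using that nb(3) nb_sub by blast
  \<comment> \<open>Here \<open>a\<close> newly dominates \<open>b\<close>, and \<open>b\<close>
    newly dominates \<open>a\<close>.\<close>
  then have "legal_seq ?H ((vs @ [a]) @ [b])"
    using extend[OF vs(1)] ab \<open>set vs \<subseteq> pverts G\<close>
    unfolding legal_seq_snoc by (auto simp: nb pverts_add_disjoint_edge)
  moreover have "length ws \<le> length ((vs @ [a]) @ [b])" if ws: "legal_seq ?H ws" for ws
  proof -
    \<comment> \<open>Entries outside \<open>G\<close> can only be \<open>a\<close> and
      \<open>b\<close>, each at most once; the remaining entries form a legal sequence of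
      \<open>G\<close>.\<close>
    have "distinct ws" and sub: "set ws \<subseteq> {a, b} \<union> pverts G"
      using ws by (auto simp: legal_seq_def pverts_add_disjoint_edge)
    then have "length (filter (\<lambda>v. v \<notin> pverts G) ws) = card (set ws - pverts G)"
      by (simp add: distinct_card[symmetric] set_diff_eq)
    also have "\<dots> \<le> card {a, b}"
      by (rule card_mono) (use sub in auto)
    also have "\<dots> = 2"
      using ab by simp
    finally have "length (filter (\<lambda>v. v \<notin> pverts G) ws) \<le> 2" .
    moreover have "length (filter (\<lambda>v. v \<in> pverts G) ws) \<le> grundy_total_dom G"
      by (rule legal_seq_length_le_grundy[OF finite_verts restrict[OF ws]])
    ultimately show ?thesis
      using sum_length_filter_compl[of "\<lambda>v. v \<in> pverts G" ws] vs(2) by simp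
  qed
  ultimately have "grundy_total_dom ?H = length ((vs @ [a]) @ [b])"
    by (intro grundy_total_dom_eqI) (auto simp: pverts_add_disjoint_edge)
  then show ?thesis
    using vs(2) by simp
qed

text \<open>Natural numbers as vertices always leave two fresh ones, so a disjoint edge can be added
  any number of times within one type.\<close>

lemma grundy_total_dom_realise_add2:
  fixes G :: "nat pair_pre_digraph"
  assumes "pair_graph G"
  shows "\<exists>H :: nat pair_pre_digraph.
    pair_graph H \<and> grundy_total_dom H = grundy_total_dom G + 2 * k"
proof (induction k)
  case 0
  then show ?case using assms by auto
next
  case (Suc k)
  then obtain H :: "nat pair_pre_digraph"
    where H: "pair_graph H" "grundy_total_dom H = grundy_total_dom G + 2 * k"
    by blast
  interpret pair_graph H by fact
  obtain a where a: "a \<notin> pverts H"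
    using ex_new_if_finite[OF infinite_UNIV_nat finite_verts] by auto
  obtain b where b: "b \<notin> insert a (pverts H)"
    using ex_new_if_finite[OF infinite_UNIV_nat] finite_verts by (meson finite_insert)
  show ?case
    using pair_graph_add_disjoint_edge[OF H(1), of a b]
      grundy_total_dom_add_disjoint_edge[OF H(1), of a b] a b H(2)
    by (intro exI[of _ "add_disjoint_edge H a b"]) auto
qed

text \<open>The triangles are 0, 1, 2 and 3, 4, 5. Without the bridge between 0 and 3 each would
  contribute only 2, for a total of 4; the bridge gains the fifth vertex.\<close>

definition joined_triangles :: "nat pair_pre_digraph" where
  "joined_triangles =
     (let E = {(0, 1), (0, 2), (1, 2), (3, 4), (3, 5), (4, 5), (0, 3)}
      in \<lparr>pverts = {0, 1, 2, 3, 4, 5}, parcs = E \<union> E\<inverse>\<rparr>)"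

lemma pair_graph_joined_triangles: "pair_graph joined_triangles"
  by unfold_locales
    (auto simp: joined_triangles_def Let_def symmetric_def sym_def)

lemma open_nbhd_joined_triangles:
  "open_nbhd joined_triangles 0 = {1, 2, 3}"
  "open_nbhd joined_triangles 1 = {0, 2}"
  "open_nbhd joined_triangles 2 = {0, 1}"
  "open_nbhd joined_triangles 3 = {4, 5, 0}"
  "open_nbhd joined_triangles 4 = {3, 5}"
  "open_nbhd joined_triangles 5 = {3, 4}"
  by (auto simp: open_nbhd_def joined_triangles_def Let_def)

lemma grundy_total_dom_joined_triangles: "grundy_total_dom joined_triangles = 5"
proof -
  have verts: "pverts joined_triangles = {0, 1, 2, 3, 4, 5}"
    by (simp add: joined_triangles_def Let_def)
  \<comment> \<open>Vertex 1 dominates 0 and 2; then 2 adds 1, 0 adds 3 across the bridge, 4 adds 5,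
    and 5 adds 4. Vertex 0 precedes 4 and 5 because both of these dominate 3.\<close>
  have "legal_seq joined_triangles ((((([] @ [1]) @ [2]) @ [0]) @ [4]) @ [5])"
    unfolding legal_seq_snoc
    by (simp add: legal_seq_Nil verts open_nbhd_joined_triangles[simplified])
  moreover have "length ws \<le> 5" if "legal_seq joined_triangles ws" for ws
  proof (cases "ws = []")
    case False
    have "2 \<le> card (open_nbhd joined_triangles v)" if "v \<in> pverts joined_triangles" for v
      using that unfolding verts
      by (elim insertE) (simp_all only: open_nbhd_joined_triangles, simp_all)
    \<comment> \<open>With six vertices and \<open>d = 2\<close> the bound reads
      \<open>length ws + 2 \<le> 7\<close>.\<close>
    from legal_seq_length_min_degree[OF _ this \<open>legal_seq joined_triangles ws\<close> False]
    show ?thesis by (simp add: verts)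
  qed simp
  ultimately have "grundy_total_dom joined_triangles =
      length ((((([] @ [1]) @ [2]) @ [0]) @ [4]) @ [5::nat])"
    by (intro grundy_total_dom_eqI) (auto simp: verts eval_nat_numeral)
  then show ?thesis by simp
qed

theorem theorem3p10:
  fixes n :: nat
  assumes "n > 0" and "n \<notin> {1, 3}"
  shows "\<exists>G :: nat pair_pre_digraph. pair_graph G \<and> grundy_total_dom G = n"
proof (cases "even n")
  case True
  let ?E = "\<lparr>pverts = {}, parcs = {}\<rparr> :: nat pair_pre_digraph"
  have "pair_graph ?E"
    by unfold_locales (auto simp: symmetric_def sym_def)
  moreover have "grundy_total_dom ?E = length ([] :: nat list)"
    by (rule grundy_total_dom_eqI) (auto simp: legal_seq_def)
  ultimately show ?thesis
    using grundy_total_dom_realise_add2[of ?E "n div 2"] True by simp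
next
  case False
  \<comment> \<open>An odd \<open>n\<close> other than 1 and 3 is at least 5, so the truncated
    subtraction is exact.\<close>
  then have "n = 5 + 2 * ((n - 5) div 2)"
    using assms by (auto elim!: oddE)
  then show ?thesis
    using grundy_total_dom_realise_add2[OF pair_graph_joined_triangles, of "(n - 5) div 2"]
    by (simp add: grundy_total_dom_joined_triangles)
qed

end
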